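(* Let $$\omega(x)=\begin{cases}e^{-\sqrt{2\pi x}}, & x\geq0,\\ 1,& x<0.\end{cases}$$ For any $T>0$, for any $\varepsilon\in(0,1)$, there exists $\psi\in L^2(\mathbb R)$ such that $$\operatorname{supp}\psi\subset[0,T],\qquad|\mathcal F\psi|\leq\omega,$$ and on one of the intervals $(-1,-1/2)$ or $(1/2,1)$, we have $$|\mathcal F\psi(x)|\geq C\,T^6(1-\varepsilon)^6\,\omega(x)\,e^{-\frac{3^{3/4}}{4T(1-\varepsilon)}},$$ for some numerical constant $C>0$.
   Context: The Fourier transform is $\mathcal Ff(\xi)=\int_{\mathbb R}e^{-2\pi i x\xi}f(x)\,dx$.
   Formalization: The constant C may depend on an upper bound T0 for T (for every T0>0 one C serves all 0<T≤T0 and all ε); an absolute C for all T>0 is impossible, since |Fψ|≤ω would force C T^6(1-ε)^6 e^{-3^{3/4}/(4T(1-ε))}≤1, which fails as T→∞. *)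

theory Defs
  imports "HOL-Analysis.Analysis"
begin

definition square_integrable :: "(real \<Rightarrow> complex) \<Rightarrow> bool" where
  "square_integrable f \<longleftrightarrow>
     f \<in> borel_measurable lborel \<and> integrable lborel (\<lambda>x. (cmod (f x))\<^sup>2)"

text \<open>The support of a class of functions modulo null sets: the complement of the largest
  open set on which the function vanishes almost everywhere.\<close>

definition ess_supp :: "(real \<Rightarrow> complex) \<Rightarrow> real set" where
  "ess_supp f = - \<Union> {U. open U \<and> (AE x in lborel. x \<in> U \<longrightarrow> f x = 0)}"

text \<open>The integral formula is meaningful for integrable functions, in particular for
  square-integrable functions whose essential support is bounded.\<close>

definition fourier :: "(real \<Rightarrow> complex) \<Rightarrow> real \<Rightarrow> complex" where
  "fourier f \<xi> = (LINT x|lborel. exp (- 2 * of_real pi * \<i> * of_real x * of_real \<xi>) * f x)"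

definition omega :: "real \<Rightarrow> real" where
  "omega x = (if x \<ge> 0 then exp (- sqrt (2 * pi * x)) else 1)"

end

theory Submission
  imports Defs "HOL-Complex_Analysis.Cauchy_Integral_Theorem"
begin

text \<open>
  The function \<open>\<psi>\<close> is an explicit oscillating bump of length \<open>S \<le> T (1 - \<epsilon>)\<close>. Rescaled to \<open>[-1, 1]\<close>
  and with \<open>k = \<pi> S \<xi>\<close>, its Fourier integral at \<open>\<xi>\<close> is, up to a factor of modulus \<open>1/2\<close>, the integral of

    \<open>(1 - z^2) / (z - i)^4 * exp (-i (a z / (1 - z^2) + k z))\<close>,   \<open>a = 1 / S\<close>,

  over the real segment. On that segment the exponential has modulus 1, which settles the
  bound by 1 for \<open>\<xi> < 0\<close>. The phase \<open>z / (1 - z^2)\<close> has nonpositive imaginary part in the lower half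
  plane, so the integrand is continuous on the closed lower half of the unit disc, essential
  singularities at \<open>1\<close> and \<open>-1\<close> included, and Cauchy's theorem moves the integral to the lower half
  of the unit circle (\<open>kernel_arc_integral\<close>). This is the path of steepest descent of
  \<open>exp (-i a z / (1 - z^2))\<close> through its critical point \<open>-i\<close>: at \<open>z = sin p - i cos p\<close> the integrand becomes

    \<open>cos p / (2 (1 + cos p)^2) * exp (- a / (2 cos p) - k cos p) * exp (-i k sin p)\<close>.

  Both estimates can be read off from this formula. If \<open>\<xi> \<ge> 0\<close>, the inequality of the arithmetic and
  geometric means gives \<open>a / (2 cos p) + k cos p \<ge> sqrt (2 a k) = sqrt (2 \<pi> \<xi>)\<close>, which is exactly the
  exponent of \<open>omega\<close>. If \<open>0 \<le> k \<le> 1\<close>, the real part of the integrand is nonnegative everywhere and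
  at least a constant times \<open>exp (- 5 a / 9)\<close> for \<open>\<bar>p\<bar> \<le> 1/3\<close>, so nothing cancels. The peak at
  \<open>p = 0\<close> would allow any exponent above \<open>a / 2\<close>, whereas the claim asks for \<open>(3 powr (3/4) / 4) a\<close>, and
  \<open>5/9\<close> lies between \<open>1/2\<close> and \<open>3 powr (3/4) / 4\<close>. Because the exponential rate is already better
  than required, the polynomial factors in the claim only have to be bounded, by \<open>T0 ^ 6\<close>.
\<close>

section \<open>The kernel on the lower half disc\<close>

text \<open>The denominator is chosen so that, on the half circle, the prefactor times \<open>dz\<close> is a positive
  measure: with \<open>z = sin p - i cos p\<close> both \<open>1 - z^2\<close> and \<open>(z - i)^2\<close> are real multiples of \<open>i z\<close>, so the
  fourth power cancels the factor \<open>z^2\<close> that the numerator and \<open>dz\<close> contribute. Its pole \<open>i\<close>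
  lies on the other side of the real axis. The zeros of the numerator tame the essential
  singularities at \<open>1\<close> and \<open>-1\<close>; there the formula takes the value 0, since division
  by zero leaves the exponential finite.\<close>

definition bump_kernel :: "real \<Rightarrow> real \<Rightarrow> complex \<Rightarrow> complex" where
  "bump_kernel a k z = (1 - z\<^sup>2) / (z - \<i>) ^ 4 * exp (- \<i> * (a * (z / (1 - z\<^sup>2)) + k * z))"

definition lower_half_disc :: "complex set" where
  "lower_half_disc = cball 0 1 \<inter> {z. Im z \<le> 0}"

text \<open>\<open>z / (1 - z^2)\<close> is half the difference of \<open>1 / (1 - z)\<close> and \<open>1 / (1 + z)\<close>, and both
  \<open>1 / (1 - z)\<close> and \<open>- 1 / (1 + z)\<close> have as imaginary part a nonnegative multiple of \<open>Im z\<close>.\<close>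

lemma Im_phase_nonpos:
  assumes "Im z \<le> 0"
  shows "Im (z / (1 - z\<^sup>2)) \<le> 0"
proof -
  have "Im (z / (1 - z\<^sup>2)) = Im z * (1 + (cmod z)\<^sup>2) / (cmod (1 - z\<^sup>2))\<^sup>2"
    unfolding Im_divide cmod_power2 by (simp add: power2_eq_square algebra_simps)
  with assms show ?thesis
    by (simp add: divide_nonpos_nonneg mult_nonpos_nonneg)
qed

lemma norm_minus_ii_ge_1:
  assumes "Im z \<le> 0"
  shows "1 \<le> cmod (z - \<i>)"
  using abs_Im_le_cmod[of "z - \<i>"] assms by simp

lemma norm_kernel_le:
  assumes "0 \<le> a" "Im z \<le> 0"
  shows "cmod (bump_kernel a k z) \<le> cmod (1 - z\<^sup>2) * exp (k * Im z)"
proof -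
  have "1 \<le> cmod ((z - \<i>) ^ 4)"
    unfolding norm_power using norm_minus_ii_ge_1[OF assms(2)] by (rule one_le_power)
  then have "cmod (1 - z\<^sup>2) / cmod ((z - \<i>) ^ 4) \<le> cmod (1 - z\<^sup>2) / 1"
    by (intro divide_left_mono) auto
  then have 1: "cmod ((1 - z\<^sup>2) / (z - \<i>) ^ 4) \<le> cmod (1 - z\<^sup>2)"
    unfolding norm_divide by linarith
  have "a * Im (z / (1 - z\<^sup>2)) \<le> 0"
    using assms(1) Im_phase_nonpos[OF assms(2)] by (rule mult_nonneg_nonpos)
  moreover have "Re (- \<i> * (a * w + k * z)) = a * Im w + k * Im z" for w :: complex
    by simp
  ultimately have "Re (- \<i> * (a * (z / (1 - z\<^sup>2)) + k * z)) \<le> k * Im z"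
    by (metis add_le_same_cancel2)
  then have 2: "cmod (exp (- \<i> * (a * (z / (1 - z\<^sup>2)) + k * z))) \<le> exp (k * Im z)"
    unfolding norm_exp_eq_Re by (rule exp_le_cancel_iff[THEN iffD2])
  show ?thesis
    unfolding bump_kernel_def norm_mult by (rule mult_mono[OF 1 2]) simp_all
qed

lemma one_minus_square_eq_0_iff: "1 - z\<^sup>2 = 0 \<longleftrightarrow> z = 1 \<or> z = (-1::complex)"
  using power2_eq_1_iff[of z] by auto

lemma kernel_field_differentiable:
  assumes "Im z \<le> 0" "z \<noteq> 1" "z \<noteq> -1"
  shows "bump_kernel a k field_differentiable at z"
proof -
  have "bump_kernel a k holomorphic_on - {\<i>, 1, -1}"
    unfolding bump_kernel_def[abs_def]
    by (intro holomorphic_intros) (use one_minus_square_eq_0_iff in auto)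
  moreover have "z \<noteq> \<i>" using assms(1) by auto
  ultimately show ?thesis
    using assms by (intro holomorphic_on_imp_differentiable_at) (auto intro!: finite_imp_closed)
qed

text \<open>At the two essential singularities \<open>norm_kernel_le\<close> squeezes the kernel to 0. This is what
  makes Cauchy's theorem applicable up to the boundary.\<close>

lemma continuous_on_kernel:
  assumes "0 \<le> a"
  shows "continuous_on lower_half_disc (bump_kernel a k)"
proof (subst continuous_on_eq_continuous_within, intro ballI)
  fix z assume z: "z \<in> lower_half_disc"
  show "continuous (at z within lower_half_disc) (bump_kernel a k)"
  proof (cases "z = 1 \<or> z = -1")
    case False
    then have "bump_kernel a k field_differentiable at z"
      using z kernel_field_differentiable unfolding lower_half_disc_def by blast
    then show ?thesis
      by (rule continuous_at_imp_continuous_at_within[OF field_differentiable_imp_continuous_at])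
  next
    case True
    then have "1 - z\<^sup>2 = 0" by auto
    have "((\<lambda>w. cmod (1 - w\<^sup>2) * exp (k * Im w)) \<longlongrightarrow> cmod (1 - z\<^sup>2) * exp (k * Im z))
        (at z within lower_half_disc)"
      by (intro tendsto_intros)
    then have "((\<lambda>w. cmod (1 - w\<^sup>2) * exp (k * Im w)) \<longlongrightarrow> 0) (at z within lower_half_disc)"
      using \<open>1 - z\<^sup>2 = 0\<close> by simp
    moreover have "eventually (\<lambda>w. norm (bump_kernel a k w) \<le> cmod (1 - w\<^sup>2) * exp (k * Im w))
        (at z within lower_half_disc)"
      using norm_kernel_le[OF assms] by (auto simp: eventually_at_filter lower_half_disc_def)
    ultimately have "(bump_kernel a k \<longlongrightarrow> 0) (at z within lower_half_disc)"
      by (rule Lim_null_comparison[rotated])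
    moreover have "bump_kernel a k z = 0"
      unfolding bump_kernel_def \<open>1 - z\<^sup>2 = 0\<close> by simp
    ultimately show ?thesis
      by (simp add: continuous_within)
  qed
qed

lemma convex_lower_half_disc: "convex lower_half_disc"
  unfolding lower_half_disc_def
  by (intro convex_Int convex_cball convex_halfspace_Im_le)

section \<open>Moving the integral to the lower half circle\<close>

definition arc_weight :: "real \<Rightarrow> real \<Rightarrow> real \<Rightarrow> real" where
  "arc_weight a k p = cos p / (2 * (1 + cos p)\<^sup>2) * exp (- (a / (2 * cos p)) - k * cos p)"

text \<open>The factor \<open>i z\<close> is the derivative of the parametrisation \<open>p \<mapsto> - i exp (i p)\<close>. On the circle
  \<open>1 / z\<close> is the conjugate of \<open>z\<close>, so \<open>z / (1 - z^2) = 1 / (1 / z - z)\<close> is purely imaginary: the phase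
  stops oscillating and turns into decay.\<close>

lemma kernel_on_arc:
  fixes p :: real
  assumes p: "p \<in> {-(pi/2)..pi/2}"
  defines "z \<equiv> - \<i> * cis p"
  shows "\<i> * z * bump_kernel a k z = arc_weight a k p * cis (- (k * sin p))"
proof -
  define c where "c = cos p"
  define s where "s = sin p"
  have c: "c \<ge> 0" using p cos_ge_zero unfolding c_def by auto
  have z: "z \<noteq> 0" unfolding z_def by auto
  have zcs: "z = s - \<i> * c"
    unfolding z_def c_def s_def cis_conv_exp by (simp add: complex_eq_iff exp_of_real Re_exp Im_exp)
  have "of_real (c * c + s * s) = (1::complex)"
    unfolding c_def s_def power2_eq_square[symmetric] by simp
  then have cs: "of_real c * of_real c + of_real s * of_real s = (1::complex)"
    by simp
  have z1: "1 - z\<^sup>2 = 2 * \<i> * z * c"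
  proof -
    have "1 - z\<^sup>2 - 2 * \<i> * z * c = 1 - (of_real c * of_real c + of_real s * of_real s)"
      unfolding zcs power2_eq_square by (simp add: algebra_simps)
    then show ?thesis by (simp add: cs)
  qed
  have z2: "(z - \<i>)\<^sup>2 = - 2 * \<i> * z * (1 + c)"
  proof -
    have "(z - \<i>)\<^sup>2 + 2 * \<i> * z * (1 + c) = (of_real c * of_real c + of_real s * of_real s) - 1"
      unfolding zcs power2_eq_square by (simp add: algebra_simps)
    then show ?thesis by (simp add: cs algebra_simps add_eq_0_iff)
  qed
  have z4: "(z - \<i>) ^ 4 = - 4 * z\<^sup>2 * (1 + c)\<^sup>2"
  proof -
    have "(z - \<i>) ^ 4 = ((z - \<i>)\<^sup>2)\<^sup>2" by simp
    then show ?thesis unfolding z2 by (simp add: power_mult_distrib)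
  qed
  have quot: "z / (1 - z\<^sup>2) = - \<i> / (2 * c)"
  proof -
    have "z / (1 - z\<^sup>2) = (z / z) / (\<i> * (2 * c))"
      unfolding z1 by (simp add: mult_ac)
    also have "\<dots> = 1 / \<i> / (2 * c)"
      using z by (simp only: divide_self divide_divide_eq_left not_False_eq_True)
    finally show ?thesis by simp
  qed
  have "\<i> * z * ((1 - z\<^sup>2) / (z - \<i>) ^ 4) = (- (2 * z\<^sup>2)) * c / ((- (2 * z\<^sup>2)) * (2 * (1 + c)\<^sup>2))"
    unfolding z1 z4 by (simp add: power2_eq_square mult_ac)
  also have "\<dots> = c / (2 * (1 + c)\<^sup>2)"
    using z by (subst mult_divide_mult_cancel_left) auto
  finally have factor: "\<i> * z * ((1 - z\<^sup>2) / (z - \<i>) ^ 4) = of_real (c / (2 * (1 + c)\<^sup>2))"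
    by simp
  have "- \<i> * (a * (z / (1 - z\<^sup>2)) + k * z)
      = of_real (- (a / (2 * c)) - k * c) + \<i> * of_real (- (k * s))"
  proof -
    have "- \<i> * (a * (z / (1 - z\<^sup>2)) + k * z) = - \<i> * a * (z / (1 - z\<^sup>2)) + - \<i> * (k * z)"
      by (simp add: ring_distribs)
    moreover have "- \<i> * a * (z / (1 - z\<^sup>2)) = of_real (- (a / (2 * c)))"
      unfolding quot by (simp add: mult_ac)
    moreover have "- \<i> * (k * z) = of_real (- (k * c)) + \<i> * of_real (- (k * s))"
      unfolding zcs by (simp add: algebra_simps)
    ultimately show ?thesis by simp
  qed
  then have "exp (- \<i> * (a * (z / (1 - z\<^sup>2)) + k * z))
      = of_real (exp (- (a / (2 * c)) - k * c)) * cis (- (k * s))"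
    by (simp only: exp_add exp_of_real cis_conv_exp)
  with factor show ?thesis
    unfolding bump_kernel_def arc_weight_def c_def[symmetric] s_def[symmetric]
    by (simp only: of_real_mult mult.assoc[symmetric])
qed

lemma half_circle_in_lower_half_disc:
  assumes "p \<in> {-(pi/2)..pi/2}"
  shows "- \<i> * cis p \<in> lower_half_disc"
  using assms cos_ge_zero[of p] by (auto simp: lower_half_disc_def norm_mult)

lemma kernel_arc_integral:
  assumes "0 \<le> a"
  obtains J where
    "((\<lambda>x. bump_kernel a k (of_real x)) has_integral J) {-1..1}"
    "((\<lambda>p. arc_weight a k p * cis (- (k * sin p))) has_integral J) {-(pi/2)..pi/2}"
proof -
  have "bump_kernel a k field_differentiable at z" if "z \<in> interior lower_half_disc - {}" for z
  proof -
    have "z \<in> ball 0 1" "Im z \<le> 0"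
      using that interior_subset unfolding lower_half_disc_def by (auto simp: interior_Int)
    then show ?thesis
      by (intro kernel_field_differentiable) auto
  qed
  then obtain g where g: "\<And>z. z \<in> lower_half_disc \<Longrightarrow>
      (g has_field_derivative bump_kernel a k z) (at z within lower_half_disc)"
    using holomorphic_convex_primitive[OF convex_lower_half_disc finite.emptyI continuous_on_kernel[OF assms]]
    by metis
  have "((\<lambda>x. bump_kernel a k (of_real x)) has_integral (g (of_real 1) - g (of_real (-1)))) {-1..1}"
  proof (rule fundamental_theorem_of_calculus)
    fix x :: real assume x: "x \<in> {-1..1}"
    have "((g \<circ> of_real) has_vector_derivative 1 * bump_kernel a k (of_real x)) (at x within {-1..1})"
    proof (rule field_vector_diff_chain_within)
      show "(of_real has_vector_derivative (1::complex)) (at x within {-1..1})"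
        by (auto intro!: derivative_eq_intros simp: mult.assoc)
      show "(g has_field_derivative bump_kernel a k (of_real x)) (at (of_real x) within of_real ` {-1..1})"
        using x by (intro DERIV_subset[OF g]) (auto simp: lower_half_disc_def)
    qed
    then show "((\<lambda>x. g (of_real x)) has_vector_derivative bump_kernel a k (of_real x)) (at x within {-1..1})"
      by (simp add: o_def)
  qed simp
  moreover have "((\<lambda>p. arc_weight a k p * cis (- (k * sin p))) has_integral
      (g (- \<i> * cis (pi/2)) - g (- \<i> * cis (-(pi/2))))) {-(pi/2)..pi/2}"
  proof (rule fundamental_theorem_of_calculus)
    fix p :: real assume p: "p \<in> {-(pi/2)..pi/2}"
    let ?c = "\<lambda>p. - \<i> * cis p"
    have "((g \<circ> ?c) has_vector_derivative (\<i> * ?c p) * bump_kernel a k (?c p)) (at p within {-(pi/2)..pi/2})"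
    proof (rule field_vector_diff_chain_within)
      show "(?c has_vector_derivative \<i> * ?c p) (at p within {-(pi/2)..pi/2})"
        unfolding cis_conv_exp
        by (rule has_vector_derivative_real_field) (auto intro!: derivative_eq_intros simp: mult.assoc)
      show "(g has_field_derivative bump_kernel a k (?c p)) (at (?c p) within ?c ` {-(pi/2)..pi/2})"
        using p half_circle_in_lower_half_disc by (intro DERIV_subset[OF g]) blast+
    qed
    then show "((\<lambda>p. g (?c p)) has_vector_derivative arc_weight a k p * cis (- (k * sin p)))
        (at p within {-(pi/2)..pi/2})"
      using kernel_on_arc[OF p] by (simp add: o_def)
  qed simp
  moreover have "- \<i> * cis (pi/2) = of_real 1" "- \<i> * cis (-(pi/2)) = of_real (-1)"
    by (auto simp: complex_eq_iff)
  ultimately show ?thesis using that by metis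
qed

section \<open>Estimates on the half circle\<close>

lemma arc_weight_nonneg:
  assumes "p \<in> {-(pi/2)..pi/2}"
  shows "0 \<le> arc_weight a k p"
  using assms cos_ge_zero[of p] by (auto simp: arc_weight_def)

text \<open>The arithmetic-geometric mean inequality, applied to \<open>a / (2 c)\<close> and \<open>k c\<close> with
  \<open>c = cos p\<close>, produces a bound that no longer depends on \<open>p\<close>.\<close>

lemma arc_weight_le:
  assumes "0 \<le> a" "0 \<le> k" and p: "p \<in> {-(pi/2)..pi/2}"
  shows "arc_weight a k p \<le> 1/2 * exp (- sqrt (2 * a * k))"
proof (cases "cos p = 0")
  case False
  define c where "c = cos p"
  have c: "0 < c" "c \<le> 1"
    using False p cos_ge_zero[of p] by (auto simp: c_def)
  have "2 * a * k \<le> (a / (2 * c) + k * c)\<^sup>2"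
  proof -
    have "(a / (2 * c) + k * c)\<^sup>2 = 2 * a * k + (a / (2 * c) - k * c)\<^sup>2"
      using c by (simp add: power2_eq_square field_simps)
    then show ?thesis by simp
  qed
  moreover have "0 \<le> a / (2 * c) + k * c" using assms c by simp
  ultimately have "sqrt (2 * a * k) \<le> a / (2 * c) + k * c"
    by (intro real_le_lsqrt)
  moreover have "c / (2 * (1 + c)\<^sup>2) \<le> 1 / 2"
  proof -
    have "c \<le> (1 + c)\<^sup>2" using c by (simp add: power2_eq_square algebra_simps)
    then show ?thesis using c by (simp add: divide_le_eq)
  qed
  ultimately show ?thesis
    unfolding arc_weight_def c_def[symmetric] by (intro mult_mono) auto
qed (simp add: arc_weight_def)

lemma one_minus_half_square_le_cos: "1 - x\<^sup>2 / 2 \<le> cos (x::real)"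
proof -
  have "(sin (x / 2))\<^sup>2 \<le> (x / 2)\<^sup>2"
    using abs_sin_x_le_abs_x[of "x / 2"] by (simp only: abs_le_square_iff)
  then show ?thesis
    using cos_double_sin[of "x / 2"] by (simp add: power_divide)
qed

text \<open>For \<open>\<bar>p\<bar> \<le> 1/3\<close> the cosine is at least \<open>9/10\<close>, which turns the exponent \<open>a / (2 cos p)\<close>
  into at most \<open>5 a / 9\<close>.\<close>

lemma arc_weight_ge:
  assumes "0 \<le> a" "0 \<le> k" "k \<le> 1" and p: "\<bar>p\<bar> \<le> 1/3"
  shows "9/80 * exp (- (5 * a / 9) - 1) \<le> arc_weight a k p"
proof -
  define c where "c = cos p"
  have "p\<^sup>2 \<le> (1/3)\<^sup>2" using p by (metis abs_le_square_iff abs_of_nonneg zero_le_divide_1_iff zero_le_numeral)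
  then have c: "9/10 \<le> c" "c \<le> 1"
    using one_minus_half_square_le_cos[of p] by (auto simp: c_def power2_eq_square)
  have "k * c \<le> 1" using assms c by (intro mult_le_one) auto
  moreover have "a / (2 * c) \<le> a / (9 / 5)"
    using assms c by (intro divide_left_mono) auto
  ultimately have "- (5 * a / 9) - 1 \<le> - (a / (2 * c)) - k * c" by simp
  moreover have "9/80 \<le> c / (2 * (1 + c)\<^sup>2)"
  proof -
    have "(1 + c)\<^sup>2 \<le> 2\<^sup>2" using c by (intro power_mono) auto
    then have "(9/10) / (2 * 4) \<le> c / (2 * (1 + c)\<^sup>2)"
      using c by (intro frac_le) auto
    then show ?thesis by simp
  qed
  ultimately show ?thesis
    unfolding arc_weight_def c_def[symmetric] by (intro mult_mono) auto
qed

lemma norm_arc_integral_le: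
  assumes "0 \<le> a" "0 \<le> k"
    and J: "((\<lambda>p. arc_weight a k p * cis (- (k * sin p))) has_integral J) {-(pi/2)..pi/2}"
  shows "cmod J \<le> 2 * exp (- sqrt (2 * a * k))"
proof -
  have "cmod J \<le> 1/2 * exp (- sqrt (2 * a * k)) * measure lborel {-(pi/2)..pi/2}"
  proof (rule has_integral_bound_real[OF _ finite.emptyI J])
    fix p assume "p \<in> {-(pi/2)..pi/2} - {}"
    then show "cmod (arc_weight a k p * cis (- (k * sin p))) \<le> 1/2 * exp (- sqrt (2 * a * k))"
      using arc_weight_le[OF assms(1,2)] arc_weight_nonneg by (simp add: norm_mult)
  qed simp
  also have "\<dots> \<le> 2 * exp (- sqrt (2 * a * k))"
    using pi_less_4 by simp
  finally show ?thesis .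
qed

text \<open>Since \<open>\<bar>k sin p\<bar> \<le> 1\<close>, the oscillating factor has real part at least \<open>1/2\<close> along the whole
  half circle, so the real part of the integral is at least what the arc \<open>\<bar>p\<bar> \<le> 1/3\<close> contributes.\<close>

lemma norm_arc_integral_ge:
  assumes "0 \<le> a" "0 \<le> k" "k \<le> 1"
    and J: "((\<lambda>p. arc_weight a k p * cis (- (k * sin p))) has_integral J) {-(pi/2)..pi/2}"
  shows "3/80 * exp (- (5 * a / 9) - 1) \<le> cmod J"
proof -
  define m where "m = 9/160 * exp (- (5 * a / 9) - 1)"
  have "((\<lambda>p::real. m) has_integral (2/3 * m)) {-(1/3)..1/3}"
    using has_integral_const_real[of m "-(1/3)" "1/3"] by simp
  moreover have "{-(1/3)..1/3} \<subseteq> {-(pi/2)..pi/2}"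
    using pi_gt3 by auto
  ultimately have "((\<lambda>p. if p \<in> {-(1/3)..1/3} then m else 0) has_integral (2/3 * m)) {-(pi/2)..pi/2}"
    by (simp only: has_integral_restrict)
  moreover have "((\<lambda>p. arc_weight a k p * cos (k * sin p)) has_integral Re J) {-(pi/2)..pi/2}"
    using has_integral_linear[OF J bounded_linear_Re] by (simp add: o_def)
  ultimately have "2/3 * m \<le> Re J"
  proof (rule has_integral_le)
    fix p assume p: "p \<in> {-(pi/2)..pi/2}"
    have "\<bar>k * sin p\<bar> \<le> 1"
      unfolding abs_mult using assms by (intro mult_le_one) auto
    then have "(k * sin p)\<^sup>2 \<le> 1" by (simp add: abs_square_le_1)
    then have cos: "1/2 \<le> cos (k * sin p)"
      using one_minus_half_square_le_cos[of "k * sin p"] by simp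
    show "(if p \<in> {-(1/3)..1/3} then m else 0) \<le> arc_weight a k p * cos (k * sin p)"
    proof (cases "p \<in> {-(1/3)..1/3}")
      case True
      then have "\<bar>p\<bar> \<le> 1/3" by auto
      from arc_weight_ge[OF assms(1-3) this]
      have "(2 * m) * (1/2) \<le> arc_weight a k p * cos (k * sin p)"
        using arc_weight_nonneg[OF p] by (intro mult_mono cos) (auto simp: m_def)
      with True show ?thesis by simp
    next
      case False
      moreover have "0 \<le> arc_weight a k p * cos (k * sin p)"
        using arc_weight_nonneg[OF p] cos by (intro mult_nonneg_nonneg) auto
      ultimately show ?thesis by presburger
    qed
  qed
  then show ?thesis
    using complex_Re_le_cmod[of J] by (simp add: m_def)
qed

section \<open>The bump and its Fourier transform\<close>

lemma continuous_on_kernel_real: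
  assumes "0 \<le> a"
  shows "continuous_on {-1..1} (\<lambda>x. bump_kernel a k (of_real x))"
  using continuous_on_kernel[OF assms, of k]
  by (rule continuous_on_compose2) (auto simp: lower_half_disc_def intro!: continuous_intros)

lemma norm_kernel_real_le_1:
  assumes "0 \<le> a" "x \<in> {-1..1}"
  shows "cmod (bump_kernel a k (of_real x)) \<le> 1"
proof -
  have "cmod (bump_kernel a k (of_real x)) \<le> cmod (of_real (1 - x\<^sup>2))"
    using norm_kernel_le[OF assms(1), of "of_real x" k] by simp
  also have "\<dots> \<le> 1"
    unfolding norm_of_real using assms(2) abs_square_le_1[of x] by (auto simp: abs_le_iff)
  finally show ?thesis .
qed

lemma kernel_modulate: "bump_kernel a 0 z * exp (- \<i> * (k * z)) = bump_kernel a k z"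
  by (simp add: bump_kernel_def exp_add[symmetric] mult.assoc algebra_simps)

definition bump :: "real \<Rightarrow> real \<Rightarrow> complex" where
  "bump S t = indicator {0..S} t *\<^sub>R (bump_kernel (1 / S) 0 (of_real (2 * t / S - 1)) / S)"

lemma square_integrable_bump:
  assumes "0 < S"
  shows "square_integrable (bump S)"
proof -
  have cont: "continuous_on {0..S} (\<lambda>t. bump_kernel (1 / S) 0 (of_real (2 * t / S - 1)) / S)"
    using assms
    by (intro continuous_intros continuous_on_compose2[OF continuous_on_kernel_real[of "1 / S" 0]])
      (auto simp: field_simps)
  then have meas: "bump S \<in> borel_measurable borel"
    unfolding bump_def[abs_def] by (intro borel_measurable_continuous_on_indicator) auto
  have "integrable lborel (\<lambda>t. indicator {0..S} t *\<^sub>R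
      (cmod (bump_kernel (1 / S) 0 (of_real (2 * t / S - 1)) / S))\<^sup>2)"
    using cont by (intro borel_integrable_compact) (auto intro!: continuous_intros)
  also have "(\<lambda>t. indicator {0..S} t *\<^sub>R
      (cmod (bump_kernel (1 / S) 0 (of_real (2 * t / S - 1)) / S))\<^sup>2) = (\<lambda>t. (cmod (bump S t))\<^sup>2)"
    by (auto simp: bump_def indicator_def)
  finally show ?thesis using meas by (simp add: square_integrable_def)
qed

lemma ess_supp_bump: "ess_supp (bump S) \<subseteq> {0..S}"
proof -
  have "- {0..S} \<in> {U. open U \<and> (AE x in lborel. x \<in> U \<longrightarrow> bump S x = 0)}"
    by (auto simp: bump_def)
  then show ?thesis unfolding ess_supp_def by blast
qed

text \<open>Centring \<open>[0, S]\<close> by \<open>t = S/2 + S/2 * y\<close> splits the character of frequency \<open>\<xi>\<close> into a constant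
  of modulus 1 and the modulation \<open>exp (-i k y)\<close> that the kernel absorbs.\<close>

lemma fourier_bump:
  assumes "0 < S"
    and J: "((\<lambda>x. bump_kernel (1 / S) (pi * S * \<xi>) (of_real x)) has_integral J) {-1..1}"
  shows "fourier (bump S) \<xi> = cis (- (pi * S * \<xi>)) * J / 2"
proof -
  let ?k = "pi * S * \<xi>"
  let ?h = "\<lambda>y. bump_kernel (1 / S) ?k (of_real y)"
  have int: "set_integrable lborel {-1..1} ?h"
    using assms by (intro borel_integrable_atLeastAtMost' continuous_on_kernel_real) simp
  have "(LINT y:{-1..1}|lborel. ?h y) = J"
    using set_borel_integral_eq_integral(2)[OF int] integral_unique[OF J] by simp
  have pointwise: "exp (- 2 * of_real pi * \<i> * of_real (S/2 + S/2 * y) * of_real \<xi>) * bump S (S/2 + S/2 * y)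
      = cis (- ?k) / S * (indicator {-1..1} y *\<^sub>R ?h y)" for y
  proof -
    have "0 \<le> S/2 * (1 + y) \<longleftrightarrow> -1 \<le> y" "0 \<le> S/2 * (1 - y) \<longleftrightarrow> y \<le> 1"
      using assms(1) by (auto simp: zero_le_mult_iff)
    then have ind: "indicator {0..S} (S/2 + S/2 * y) = (indicator {-1..1} y :: real)"
      by (auto simp: indicator_def algebra_simps)
    have arg: "2 * (S/2 + S/2 * y) / S - 1 = y"
      using assms by (simp add: field_simps)
    have "exp (- 2 * of_real pi * \<i> * of_real (S/2 + S/2 * y) * of_real \<xi>)
        = cis (- ?k) * exp (- \<i> * (?k * of_real y))"
    proof -
      have "- 2 * of_real pi * \<i> * of_real (S/2 + S/2 * y) * of_real \<xi>
          = \<i> * of_real (- ?k) + - \<i> * (?k * of_real y)"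
        by (simp add: complex_eq_iff algebra_simps)
      then show ?thesis
        unfolding cis_conv_exp exp_add[symmetric] by (simp only:)
    qed
    then show ?thesis
      unfolding bump_def ind arg kernel_modulate[symmetric, of _ ?k] by (simp add: mult_ac)
  qed
  have "fourier (bump S) \<xi>
      = \<bar>S/2\<bar> *\<^sub>R (LINT y|lborel. exp (- 2 * of_real pi * \<i> * of_real (S/2 + S/2 * y) * of_real \<xi>)
          * bump S (S/2 + S/2 * y))"
    unfolding fourier_def using assms by (intro lborel_integral_real_affine) simp
  also have "\<dots> = (S/2) *\<^sub>R (cis (- ?k) / S * (LINT y:{-1..1}|lborel. ?h y))"
    unfolding pointwise set_lebesgue_integral_def integral_mult_right_zero using assms(1) by simp
  also have "\<dots> = cis (- ?k) * J / 2"
    unfolding \<open>_ = J\<close> using assms by (simp add: scaleR_conv_of_real)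
  finally show ?thesis .
qed

text \<open>The half circle gives the bound for \<open>\<xi> \<ge> 0\<close>, where \<open>k \<ge> 0\<close> makes the modulation decay in the
  lower half plane; for \<open>\<xi> < 0\<close> it would grow, and the real segment is the right contour.\<close>

lemma norm_fourier_bump_le_omega:
  assumes "0 < S"
  shows "cmod (fourier (bump S) \<xi>) \<le> omega \<xi>"
proof -
  let ?k = "pi * S * \<xi>"
  obtain J where J: "((\<lambda>x. bump_kernel (1 / S) ?k (of_real x)) has_integral J) {-1..1}"
    and arc: "((\<lambda>p. arc_weight (1 / S) ?k p * cis (- (?k * sin p))) has_integral J) {-(pi/2)..pi/2}"
    using kernel_arc_integral[of "1 / S" ?k] assms by auto
  have norm: "cmod (fourier (bump S) \<xi>) = cmod J / 2"
    unfolding fourier_bump[OF assms J] by (simp add: norm_mult norm_divide)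
  show ?thesis
  proof (cases "0 \<le> \<xi>")
    case True
    have "cmod J \<le> 2 * exp (- sqrt (2 * (1 / S) * ?k))"
      using assms True by (intro norm_arc_integral_le[OF _ _ arc]) auto
    also have "2 * (1 / S) * ?k = 2 * pi * \<xi>" using assms by simp
    finally show ?thesis using True norm by (simp add: omega_def)
  next
    case False
    have "cmod J \<le> 1 * measure lborel {-1..1::real}"
      using norm_kernel_real_le_1[of "1 / S"] assms
      by (intro has_integral_bound_real[OF _ finite.emptyI J]) auto
    then show ?thesis using False norm by (simp add: omega_def)
  qed
qed

lemma norm_fourier_bump_ge:
  assumes "0 < S" "0 \<le> \<xi>" "pi * S * \<xi> \<le> 1"
  shows "3/160 * exp (- (5 / (9 * S)) - 1) \<le> cmod (fourier (bump S) \<xi>)"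
proof -
  let ?k = "pi * S * \<xi>"
  obtain J where J: "((\<lambda>x. bump_kernel (1 / S) ?k (of_real x)) has_integral J) {-1..1}"
    and arc: "((\<lambda>p. arc_weight (1 / S) ?k p * cis (- (?k * sin p))) has_integral J) {-(pi/2)..pi/2}"
    using kernel_arc_integral[of "1 / S" ?k] assms by auto
  have "3/80 * exp (- (5 * (1 / S) / 9) - 1) \<le> cmod J"
    using assms by (intro norm_arc_integral_ge[OF _ _ _ arc]) auto
  then show ?thesis
    unfolding fourier_bump[OF assms(1) J] by (simp add: norm_mult norm_divide mult.commute)
qed

section \<open>Choice of parameters\<close>

text \<open>In fourth powers this is \<open>160000/6561 \<le> 27\<close>. It says that the exponent \<open>5/9\<close> reached by the
  bump does not exceed \<open>3 powr (3/4) / 4\<close>.\<close>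

lemma twenty_ninths_le: "20 / 9 \<le> (3::real) powr (3/4)"
proof -
  have "(20/9) powr 4 \<le> (3::real) powr 3" by (simp add: power_divide)
  then have "((20/9) powr 4) powr (1/4) \<le> ((3::real) powr 3) powr (1/4)"
    by (intro powr_mono2) auto
  then show ?thesis unfolding powr_powr by simp
qed

theorem theorem2p4:
  fixes T0 :: real
  assumes "T0 > 0"
  shows "\<exists>C>0. \<forall>T \<epsilon> :: real. 0 < T \<and> T \<le> T0 \<and> 0 < \<epsilon> \<and> \<epsilon> < 1 \<longrightarrow>
    (\<exists>\<psi> :: real \<Rightarrow> complex.
       square_integrable \<psi> \<and>
       ess_supp \<psi> \<subseteq> {0..T} \<and>
       (\<forall>x. cmod (fourier \<psi> x) \<le> omega x) \<and>
       (\<exists>I \<in> {{-1 <..< -1/2}, {1/2 <..< 1}}. \<forall>x\<in>I.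
          cmod (fourier \<psi> x) \<ge>
            C * T ^ 6 * (1 - \<epsilon>) ^ 6 * omega x * exp (- (3 powr (3/4)) / (4 * T * (1 - \<epsilon>)))))"
proof (intro exI conjI allI impI)
  define A where "A = 3/160 * exp (- (20/9) - 1 :: real)"
  define C where "C = A / T0 ^ 6"
  show "0 < C" using assms by (simp add: C_def A_def)
  fix T \<epsilon> :: real
  assume "0 < T \<and> T \<le> T0 \<and> 0 < \<epsilon> \<and> \<epsilon> < 1"
  then have T: "0 < T" "T \<le> T0" and \<epsilon>: "0 < \<epsilon>" "\<epsilon> < 1" by auto
  define R where "R = T * (1 - \<epsilon>)"
  \<comment> \<open>Capping the length at \<open>1/4\<close> ensures \<open>\<pi> S x \<le> 1\<close> for \<open>x \<le> 1\<close>, as \<open>\<pi> < 4\<close>; it increases \<open>1 / S\<close> by at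
    most 4 over \<open>1 / R\<close>, which costs the constant factor \<open>exp (- 20/9)\<close> in \<open>A\<close>.\<close>
  define S where "S = min R (1/4)"
  have R: "0 < R" "R \<le> T" using T \<epsilon> by (auto simp: R_def mult_le_cancel_left2)
  then have S: "0 < S" "S \<le> T" "S \<le> 1/4" by (auto simp: S_def)
  show "square_integrable (bump S)" using S(1) by (rule square_integrable_bump)
  show "ess_supp (bump S) \<subseteq> {0..T}" using ess_supp_bump[of S] S(2) by auto
  show "cmod (fourier (bump S) x) \<le> omega x" for x
    using S(1) by (rule norm_fourier_bump_le_omega)
  show "\<exists>I \<in> {{-1 <..< -1/2}, {1/2 <..< 1}}. \<forall>x\<in>I. cmod (fourier (bump S) x) \<ge>
      C * T ^ 6 * (1 - \<epsilon>) ^ 6 * omega x * exp (- (3 powr (3/4)) / (4 * T * (1 - \<epsilon>)))"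
  proof (rule bexI[of _ "{1/2<..<1}"], intro ballI)
    fix x :: real assume x: "x \<in> {1/2<..<1}"
    have "1 / S \<le> 4 + 1 / R" using R by (auto simp: S_def min_def field_simps)
    moreover have "20 / 9 * (1 / R) \<le> 3 powr (3/4) * (1 / R)"
      using R by (intro mult_right_mono twenty_ninths_le) auto
    ultimately have exponent: "- (20/9) - 1 + - (3 powr (3/4)) / (4 * R) \<le> - (5 / (9 * S)) - 1"
      by (simp add: field_simps)
    have "C * T ^ 6 * (1 - \<epsilon>) ^ 6 = C * R ^ 6"
      by (simp add: R_def power_mult_distrib)
    also have "\<dots> \<le> C * T0 ^ 6"
      using \<open>0 < C\<close> R T by (intro mult_left_mono power_mono) auto
    also have "\<dots> = A" using assms by (simp add: C_def)
    finally have "C * T ^ 6 * (1 - \<epsilon>) ^ 6 \<le> A" .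
    moreover have "omega x \<le> 1" "0 \<le> omega x" using x by (auto simp: omega_def)
    moreover have "0 \<le> A" by (simp add: A_def)
    ultimately have "C * T ^ 6 * (1 - \<epsilon>) ^ 6 * omega x * exp (- (3 powr (3/4)) / (4 * T * (1 - \<epsilon>)))
        \<le> A * 1 * exp (- (3 powr (3/4)) / (4 * T * (1 - \<epsilon>)))"
      by (intro mult_right_mono mult_mono) auto
    also have "\<dots> = 3/160 * exp (- (20/9) - 1 + - (3 powr (3/4)) / (4 * R))"
      by (simp add: A_def R_def mult_ac flip: exp_add)
    also have "\<dots> \<le> 3/160 * exp (- (5 / (9 * S)) - 1)"
      using exponent by simp
    also have "\<dots> \<le> cmod (fourier (bump S) x)"
    proof (rule norm_fourier_bump_ge[OF S(1)])
      have "pi * S * x \<le> 4 * (1/4) * 1"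
        using S x pi_less_4 by (intro mult_mono) auto
      then show "pi * S * x \<le> 1" by simp
    qed (use x in auto)
    finally show "cmod (fourier (bump S) x) \<ge>
      C * T ^ 6 * (1 - \<epsilon>) ^ 6 * omega x * exp (- (3 powr (3/4)) / (4 * T * (1 - \<epsilon>)))" .
  qed simp
qed

end
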